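(* Let $N\ge 1$ and let $p$ be any point of $W_N$ (i.e. any nonzero vector of $\mathbb{F}_2^{2N}$). The perpset of $p$ is non-contextual; that is, writing $A$ for the incidence matrix and $E$ for the valuation vector of the quantum configuration given by the perpset of $p$, the linear system $Ax=E$ has a solution over $\mathbb{F}_2$.
   Context: $W_N=\mathcal{W}(2N-1,2)$ is the symplectic polar space on $\mathbb{F}_2^{2N}$ with symplectic form $\langle x|y\rangle=\sum_{i=1}^N (x_iy_{N+i}+x_{N+i}y_i)$. Its points are the nonzero vectors of $\mathbb{F}_2^{2N}$; its lines are the totally isotropic vector subspaces of dimension 2 with the zero vector removed, i.e. sets $\{a,b,a+b\}$ with $a\neq b$ nonzero and $\langle a|b\rangle=0$. Let $I$ be the $2\times2$ identity matrix and $X=\begin{pmatrix}0&1\\1&0\end{pmatrix}$, $Y=\begin{pmatrix}0&-\mathrm{i}\\ \mathrm{i}&0\end{pmatrix}$, $Z=\begin{pmatrix}1&0\\0&-1\end{pmatrix}$. A point $(g_1,\dots,g_{2N})$ is identified with the (phase-free) $N$-qubit observable $G_1\otimes\cdots\otimes G_N$, $G_j\in\{I,X,Y,Z\}$, where $(g_j,g_{j+N})=(0,0),(0,1),(1,1),(1,0)$ corresponds to $G_j=I,X,Y,Z$ respectively. Two observables commute iff their vectors are orthogonal for the symplectic form. A quantum configuration is a pair $(O,C)$, with $O$ a finite set of observables and $C$ a finite set of subsets of $O$ (contexts), such that each $M\in O$ satisfies $M^2=I^{\otimes N}$, observables in the same context commute, and the matrix product of all observables of each context is $I^{\otimes N}$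 (positive context) or $-I^{\otimes N}$ (negative context). Its incidence matrix $A\in\mathbb{F}_2^{|C|\times|O|}$ has $A_{i,j}=1$ iff the $i$-th context contains the $j$-th observable; its valuation vector $E\in\mathbb{F}_2^{|C|}$ has $E_i=0$ if the $i$-th context is positive and $E_i=1$ if it is negative. The configuration is contextual iff $Ax=E$ has no solution $x\in\mathbb{F}_2^{|O|}$, and non-contextual otherwise. The perpset of a point $p\in W_N$ is the configuration whose points (observables) are all points $q$ of $W_N$ with $\langle p|q\rangle=0$ and whose contexts are all the lines of $W_N$ containing $p$. *)

theory Defs
  imports
    "HOL-Library.Z2"
    "Jordan_Normal_Form.Matrix"
    "Jordan_Normal_Form.Schur_Decomposition"
begin

text \<open>The field with two elements is the type \<open>bit\<close>. Coordinates are counted from 0, so the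
  pair \<open>(x\<^sub>i, x\<^sub>N\<^sub>+\<^sub>i)\<close> with \<open>i\<close> from 1 to \<open>N\<close> is \<open>(x $ i, x $ (N + i))\<close> with \<open>i < N\<close>.\<close>

definition symp :: "nat \<Rightarrow> bit vec \<Rightarrow> bit vec \<Rightarrow> bit" where
  "symp N x y = (\<Sum>i<N. x $ i * y $ (N + i) + x $ (N + i) * y $ i)"

definition W_points :: "nat \<Rightarrow> bit vec set" where
  "W_points N = carrier_vec (2 * N) - {0\<^sub>v (2 * N)}"

definition W_lines :: "nat \<Rightarrow> bit vec set set" where
  "W_lines N = {{a, b, a + b} | a b.
     a \<in> W_points N \<and> b \<in> W_points N \<and> a \<noteq> b \<and> symp N a b = 0}"

definition pauli_X :: "complex mat" where
  "pauli_X = mat_of_rows_list 2 [[0, 1], [1, 0]]"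

definition pauli_Y :: "complex mat" where
  "pauli_Y = mat_of_rows_list 2 [[0, - \<i>], [\<i>, 0]]"

definition pauli_Z :: "complex mat" where
  "pauli_Z = mat_of_rows_list 2 [[1, 0], [0, - 1]]"

definition qubit_gate :: "bit \<Rightarrow> bit \<Rightarrow> complex mat" where
  "qubit_gate g h =
     (if g = 0 \<and> h = 0 then 1\<^sub>m 2
      else if g = 0 \<and> h = 1 then pauli_X
      else if g = 1 \<and> h = 1 then pauli_Y
      else pauli_Z)"

definition kronecker :: "'a :: semiring_1 mat \<Rightarrow> 'a mat \<Rightarrow> 'a mat" where
  "kronecker A B = mat (dim_row A * dim_row B) (dim_col A * dim_col B)
     (\<lambda>(i, j). A $$ (i div dim_row B, j div dim_col B) * B $$ (i mod dim_row B, j mod dim_col B))"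

text \<open>The \<open>1 \<times> 1\<close> identity matrix is neutral for the Kronecker product.\<close>

definition pauli_obs :: "nat \<Rightarrow> bit vec \<Rightarrow> complex mat" where
  "pauli_obs N g = foldr kronecker (map (\<lambda>j. qubit_gate (g $ j) (g $ (N + j))) [0..<N]) (1\<^sub>m 1)"

definition observable :: "nat \<Rightarrow> complex mat \<Rightarrow> bool" where
  "observable N M \<longleftrightarrow> M \<in> carrier_mat (2 ^ N) (2 ^ N) \<and> mat_adjoint M = M"

text \<open>The observables of a context commute, so the order in which they are multiplied is
  immaterial; the definition asks for the same product in every order.\<close>

definition context_product :: "nat \<Rightarrow> complex mat set \<Rightarrow> complex mat \<Rightarrow> bool" where
  "context_product N c P \<longleftrightarrow> finite c \<and>
     (\<forall>ms. distinct ms \<and> set ms = c \<longrightarrow> foldr (*) ms (1\<^sub>m (2 ^ N)) = P)"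

definition positive_context :: "nat \<Rightarrow> complex mat set \<Rightarrow> bool" where
  "positive_context N c \<longleftrightarrow> context_product N c (1\<^sub>m (2 ^ N))"

definition negative_context :: "nat \<Rightarrow> complex mat set \<Rightarrow> bool" where
  "negative_context N c \<longleftrightarrow> context_product N c (- 1\<^sub>m (2 ^ N))"

definition quantum_configuration ::
  "nat \<Rightarrow> complex mat set \<Rightarrow> complex mat set set \<Rightarrow> bool" where
  "quantum_configuration N Obs C \<longleftrightarrow>
     finite Obs \<and> finite C \<and> (\<forall>c\<in>C. c \<subseteq> Obs) \<and>
     (\<forall>M\<in>Obs. observable N M \<and> M * M = 1\<^sub>m (2 ^ N)) \<and>
     (\<forall>c\<in>C. \<forall>A\<in>c. \<forall>B\<in>c. A * B = B * A) \<and>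
     (\<forall>c\<in>C. positive_context N c \<or> negative_context N c)"

text \<open>Rows and columns are numbered by means of an enumeration \<open>cs\<close> of the contexts and an
  enumeration \<open>os\<close> of the observables.\<close>

definition incidence_matrix :: "complex mat set list \<Rightarrow> complex mat list \<Rightarrow> bit mat" where
  "incidence_matrix cs os =
     mat (length cs) (length os) (\<lambda>(i, j). if os ! j \<in> cs ! i then 1 else 0)"

definition valuation_vector :: "nat \<Rightarrow> complex mat set list \<Rightarrow> bit vec" where
  "valuation_vector N cs =
     vec (length cs) (\<lambda>i. if negative_context N (cs ! i) then 1 else 0)"

text \<open>Another choice of enumerations permutes the equations and the unknowns of the linear
  system, so for finite \<open>Obs\<close> and \<open>C\<close> solvability does not depend on it.\<close>

definition contextual :: "nat \<Rightarrow> complex mat set \<Rightarrow> complex mat set set \<Rightarrow> bool" where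
  "contextual N Obs C \<longleftrightarrow>
     (\<exists>os cs. distinct os \<and> set os = Obs \<and> distinct cs \<and> set cs = C \<and>
        \<not> (\<exists>x \<in> carrier_vec (length os).
              incidence_matrix cs os *\<^sub>v x = valuation_vector N cs))"

definition perpset_points :: "nat \<Rightarrow> bit vec \<Rightarrow> bit vec set" where
  "perpset_points N p = {q \<in> W_points N. symp N p q = 0}"

definition perpset_lines :: "nat \<Rightarrow> bit vec \<Rightarrow> bit vec set set" where
  "perpset_lines N p = {l \<in> W_lines N. p \<in> l}"

text \<open>The map \<open>pauli_obs N\<close> is injective on \<open>carrier_vec (2 * N)\<close>; it is the identification of
  points with observables.\<close>

definition perpset_observables :: "nat \<Rightarrow> bit vec \<Rightarrow> complex mat set" where
  "perpset_observables N p = pauli_obs N ` perpset_points N p"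

definition perpset_contexts :: "nat \<Rightarrow> bit vec \<Rightarrow> complex mat set set" where
  "perpset_contexts N p = (\<lambda>l. pauli_obs N ` l) ` perpset_lines N p"

end

theory Submission
  imports Defs
begin

text \<open>Two distinct lines through \<open>p\<close> meet only in \<open>p\<close>, so the
  equations of the perpset are coupled through the unknown of \<open>p\<close> alone. Once that
  unknown is set to 0, every context has two private unknowns, and giving one of them the sign of
  the context solves all equations at once. To choose between \<open>q\<close> and
  \<open>p + q\<close> uniformly, fix a coordinate \<open>i\<close> where \<open>p\<close> is 1:
  exactly one of the two vanishes there. This is \<open>perpset_valuation\<close>; it rests on
  \<open>perpset_contexts_unique\<close>, and \<open>incidence_mult_vec\<close> translates it into
  the matrix equation.

  It remains to see that the perpset is a quantum configuration. Pauli operators are Hermitian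
  involutions that commute or anticommute according to the symplectic form
  (\<open>pauli_on_commute\<close>) and multiply like their vectors up to a scalar
  (\<open>pauli_on_mult\<close>). Squaring the product of two commuting ones shows that this scalar
  is 1 or -1 (\<open>pauli_obs_line\<close>). Injectivity (\<open>inj_on_pauli_obs\<close>) carries
  the geometry of points over to matrices.\<close>

section \<open>Kronecker products\<close>

lemma dim_kronecker [simp]:
  "dim_row (kronecker A B) = dim_row A * dim_row B"
  "dim_col (kronecker A B) = dim_col A * dim_col B"
  by (simp_all add: kronecker_def)

lemma index_kronecker:
  assumes "i < dim_row A * dim_row B" "j < dim_col A * dim_col B"
  shows "kronecker A B $$ (i, j) =
    A $$ (i div dim_row B, j div dim_col B) * B $$ (i mod dim_row B, j mod dim_col B)"
  using assms by (simp add: kronecker_def)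

lemma block_index_less:
  fixes i n m k :: nat
  assumes "i < n" "k < m"
  shows "i * m + k < n * m"
proof -
  have "i * m + k < Suc i * m" using assms by simp
  also have "\<dots> \<le> n * m" using assms by (intro mult_right_mono) auto
  finally show ?thesis .
qed

lemma index_kronecker_block:
  assumes "i < dim_row A" "j < dim_col A" "k < dim_row B" "l < dim_col B"
  shows "kronecker A B $$ (i * dim_row B + k, j * dim_col B + l) = A $$ (i, j) * B $$ (k, l)"
  using assms by (subst index_kronecker) (auto intro: block_index_less)

text \<open>Cutting the range into \<open>n\<close> blocks of length \<open>m\<close> makes the
  quotient constant on each block while the remainder runs through all its values.\<close>

lemma sum_div_mod:
  fixes f :: "nat \<Rightarrow> 'a :: comm_semiring_0" and g :: "nat \<Rightarrow> 'a"
  shows "(\<Sum>k<n * m. f (k div m) * g (k mod m)) = (\<Sum>i<n. f i) * (\<Sum>j<m. g j)"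
proof -
  have "(\<Sum>k<n * m. f (k div m) * g (k mod m)) =
      (\<Sum>i<n. \<Sum>k = i * m..<i * m + m. f (k div m) * g (k mod m))"
    by (rule sum.nat_group [symmetric])
  also have "\<dots> = (\<Sum>i<n. \<Sum>j<m. f i * g j)"
  proof (rule sum.cong [OF refl])
    fix i
    have "(\<Sum>k = i * m..<i * m + m. f (k div m) * g (k mod m)) =
        (\<Sum>j = 0..<m. f ((j + i * m) div m) * g ((j + i * m) mod m))"
      using sum.shift_bounds_nat_ivl [of "\<lambda>k. f (k div m) * g (k mod m)" 0 "i * m" m]
      by (simp add: add.commute)
    also have "\<dots> = (\<Sum>j<m. f i * g j)"
      by (rule sum.cong) auto
    finally show "(\<Sum>k = i * m..<i * m + m. f (k div m) * g (k mod m)) = (\<Sum>j<m. f i * g j)" .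
  qed
  finally show ?thesis by (simp add: sum_product)
qed

text \<open>The mixed-product rule: the summation index splits into quotient and remainder, and
  \<open>sum_div_mod\<close> factors the sum.\<close>

lemma kronecker_mult:
  fixes A :: "'a :: comm_semiring_1 mat"
  assumes "dim_col A = dim_row C" "dim_col B = dim_row D"
  shows "kronecker A B * kronecker C D = kronecker (A * C) (B * D)"
proof (rule eq_matI)
  fix i j
  assume "i < dim_row (kronecker (A * C) (B * D))" "j < dim_col (kronecker (A * C) (B * D))"
  then have ij: "i < dim_row A * dim_row B" "j < dim_col C * dim_col D" by simp_all
  then have "0 < dim_row B" "0 < dim_col D"
    by (metis less_nat_zero_code mult_0_right neq0_conv)+
  with ij have dm: "i div dim_row B < dim_row A" "i mod dim_row B < dim_row B"
    "j div dim_col D < dim_col C" "j mod dim_col D < dim_col D"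
    by (simp_all add: less_mult_imp_div_less)
  let ?f = "\<lambda>k. A $$ (i div dim_row B, k) * C $$ (k, j div dim_col D)"
  let ?g = "\<lambda>k. B $$ (i mod dim_row B, k) * D $$ (k, j mod dim_col D)"
  have "(kronecker A B * kronecker C D) $$ (i, j) =
      (\<Sum>k<dim_row C * dim_row D. ?f (k div dim_row D) * ?g (k mod dim_row D))"
    using ij assms
    by (auto simp: scalar_prod_def index_kronecker atLeast0LessThan ac_simps intro!: sum.cong)
  also have "\<dots> = (\<Sum>k<dim_row C. ?f k) * (\<Sum>k<dim_row D. ?g k)"
    by (rule sum_div_mod)
  also have "\<dots> = kronecker (A * C) (B * D) $$ (i, j)"
    using ij dm assms by (simp add: index_kronecker scalar_prod_def atLeast0LessThan)
  finally show "(kronecker A B * kronecker C D) $$ (i, j) = kronecker (A * C) (B * D) $$ (i, j)" .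
qed simp_all

lemma kronecker_one: "kronecker (1\<^sub>m n) (1\<^sub>m m) = 1\<^sub>m (n * m)"
proof (rule eq_matI)
  fix i j
  assume "i < dim_row (1\<^sub>m (n * m))" "j < dim_col (1\<^sub>m (n * m))"
  then have ij: "i < n * m" "j < n * m" by simp_all
  then have "0 < m" by (metis less_nat_zero_code mult_0_right neq0_conv)
  moreover have "i = j \<longleftrightarrow> i div m = j div m \<and> i mod m = j mod m"
    by (metis div_mult_mod_eq)
  ultimately show "kronecker (1\<^sub>m n) (1\<^sub>m m) $$ (i, j) = 1\<^sub>m (n * m) $$ (i, j)"
    using ij by (auto simp: index_kronecker less_mult_imp_div_less)
qed simp_all

lemma kronecker_smult:
  fixes A :: "'a :: comm_semiring_1 mat"
  shows "kronecker (a \<cdot>\<^sub>m A) (b \<cdot>\<^sub>m B) = (a * b) \<cdot>\<^sub>m kronecker A B"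
proof (rule eq_matI)
  fix i j
  assume "i < dim_row ((a * b) \<cdot>\<^sub>m kronecker A B)" "j < dim_col ((a * b) \<cdot>\<^sub>m kronecker A B)"
  then have ij: "i < dim_row A * dim_row B" "j < dim_col A * dim_col B" by simp_all
  then have "0 < dim_row B" "0 < dim_col B"
    by (metis less_nat_zero_code mult_0_right neq0_conv)+
  with ij show "kronecker (a \<cdot>\<^sub>m A) (b \<cdot>\<^sub>m B) $$ (i, j) = ((a * b) \<cdot>\<^sub>m kronecker A B) $$ (i, j)"
    by (simp add: index_kronecker less_mult_imp_div_less ac_simps)
qed simp_all

lemma mat_adjoint_index:
  assumes "i < dim_col A" "j < dim_row A"
  shows "mat_adjoint A $$ (i, j) = conjugate (A $$ (j, i))"
  using assms by (simp add: mat_adjoint_def mat_of_rows_def)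

lemma dim_mat_adjoint [simp]:
  "dim_row (mat_adjoint A) = dim_col A" "dim_col (mat_adjoint A) = dim_row A"
  by (simp_all add: mat_adjoint_def mat_of_rows_def)

lemma kronecker_adjoint:
  fixes A :: "complex mat"
  shows "mat_adjoint (kronecker A B) = kronecker (mat_adjoint A) (mat_adjoint B)"
proof (rule eq_matI)
  fix i j
  assume "i < dim_row (kronecker (mat_adjoint A) (mat_adjoint B))"
    "j < dim_col (kronecker (mat_adjoint A) (mat_adjoint B))"
  then have ij: "i < dim_col A * dim_col B" "j < dim_row A * dim_row B" by simp_all
  then have "0 < dim_row B" "0 < dim_col B"
    by (metis less_nat_zero_code mult_0_right neq0_conv)+
  with ij show "mat_adjoint (kronecker A B) $$ (i, j) =
      kronecker (mat_adjoint A) (mat_adjoint B) $$ (i, j)"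
    by (simp add: index_kronecker mat_adjoint_index less_mult_imp_div_less)
qed simp_all

section \<open>Pauli matrices\<close>

lemma qubit_gate_carrier [simp]: "qubit_gate g h \<in> carrier_mat 2 2"
  by (cases g; cases h)
    (auto simp: qubit_gate_def pauli_X_def pauli_Y_def pauli_Z_def mat_of_rows_list_def
      intro!: carrier_matI)

lemma dim_qubit_gate [simp]: "dim_row (qubit_gate g h) = 2" "dim_col (qubit_gate g h) = 2"
  using carrier_matD [OF qubit_gate_carrier] by blast+

text \<open>The bit \<open>h\<close> decides between diagonal and antidiagonal, and \<open>g\<close>
  fixes the phase. With this table, identities between gates become finite checks over bits and
  entries.\<close>

lemma qubit_gate_index:
  "qubit_gate g h $$ (0, 0) = (if h = 0 then 1 else 0)"
  "qubit_gate g h $$ (0, Suc 0) = (if h = 0 then 0 else if g = 0 then 1 else - \<i>)"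
  "qubit_gate g h $$ (Suc 0, 0) = (if h = 0 then 0 else if g = 0 then 1 else \<i>)"
  "qubit_gate g h $$ (Suc 0, Suc 0) = (if h = 0 then if g = 0 then 1 else - 1 else 0)"
  by (cases g; cases h;
      simp add: qubit_gate_def pauli_X_def pauli_Y_def pauli_Z_def mat_of_rows_list_def)+

lemma mat_2_eqI:
  assumes "dim_row A = 2" "dim_col A = 2" "dim_row B = 2" "dim_col B = 2"
    "A $$ (0, 0) = B $$ (0, 0)" "A $$ (0, Suc 0) = B $$ (0, Suc 0)"
    "A $$ (Suc 0, 0) = B $$ (Suc 0, 0)" "A $$ (Suc 0, Suc 0) = B $$ (Suc 0, Suc 0)"
  shows "A = B"
  using assms by (intro eq_matI) (auto simp: less_2_cases_iff)

lemma index_mult_2: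
  assumes "dim_row A = 2" "dim_col A = 2" "dim_row B = 2" "dim_col B = 2" "i < 2" "j < 2"
  shows "(A * B) $$ (i, j) = A $$ (i, 0) * B $$ (0, j) + A $$ (i, Suc 0) * B $$ (Suc 0, j)"
  using assms by (auto simp: scalar_prod_def numeral_2_eq_2)

lemma qubit_gate_adjoint: "mat_adjoint (qubit_gate g h) = qubit_gate g h"
  by (rule mat_2_eqI) (auto simp: mat_adjoint_index qubit_gate_index)

lemma qubit_gate_square: "qubit_gate g h * qubit_gate g h = 1\<^sub>m 2"
  by (rule mat_2_eqI) (simp_all add: index_mult_2 qubit_gate_index del: index_mult_mat(1))

text \<open>The gates form a projective representation of the additive group of bit pairs. The
  scalar can stay unspecified, since on a line it is later pinned down by squaring.\<close>

lemma qubit_gate_mult: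
  "\<exists>c. qubit_gate g h * qubit_gate g' h' = c \<cdot>\<^sub>m qubit_gate (g + g') (h + h')"
proof -
  let ?P = "qubit_gate g h * qubit_gate g' h'"
  let ?c = "if h = h' then ?P $$ (0, 0) else
    ?P $$ (0, Suc 0) / qubit_gate (g + g') (h + h') $$ (0, Suc 0)"
  have "?P = ?c \<cdot>\<^sub>m qubit_gate (g + g') (h + h')"
    by (rule mat_2_eqI; cases g; cases h; cases g'; cases h')
      (simp_all add: index_mult_2 qubit_gate_index del: index_mult_mat(1))
  then show ?thesis by blast
qed

lemma qubit_gate_commute:
  "qubit_gate g h * qubit_gate g' h' =
     (if g * h' + h * g' = 0 then 1 else - 1) \<cdot>\<^sub>m (qubit_gate g' h' * qubit_gate g h)"
  by (rule mat_2_eqI; cases g; cases h; cases g'; cases h')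
    (simp_all add: index_mult_2 qubit_gate_index del: index_mult_mat(1))

section \<open>Tensor products of Pauli gates\<close>

text \<open>An arbitrary list of qubits and two free bit functions replace the range
  \<open>[0..<N]\<close> and the offset \<open>N + j\<close> of \<open>pauli_obs\<close>, so that
  induction on the list goes through.\<close>

definition pauli_on :: "nat list \<Rightarrow> (nat \<Rightarrow> bit) \<Rightarrow> (nat \<Rightarrow> bit) \<Rightarrow> complex mat" where
  "pauli_on js g h = foldr kronecker (map (\<lambda>j. qubit_gate (g j) (h j)) js) (1\<^sub>m 1)"

lemma pauli_on_Nil [simp]: "pauli_on [] g h = 1\<^sub>m 1"
  by (simp add: pauli_on_def)

lemma pauli_on_Cons [simp]:
  "pauli_on (j # js) g h = kronecker (qubit_gate (g j) (h j)) (pauli_on js g h)"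
  by (simp add: pauli_on_def)

lemma dim_pauli_on [simp]:
  "dim_row (pauli_on js g h) = 2 ^ length js" "dim_col (pauli_on js g h) = 2 ^ length js"
  by (induction js) simp_all

lemma pauli_on_carrier [simp]: "pauli_on js g h \<in> carrier_mat (2 ^ length js) (2 ^ length js)"
  by (rule carrier_matI) simp_all

lemma pauli_on_adjoint: "mat_adjoint (pauli_on js g h) = pauli_on js g h"
proof (induction js)
  case Nil
  show ?case by (rule eq_matI) (auto simp: mat_adjoint_index)
qed (simp add: kronecker_adjoint qubit_gate_adjoint)

lemma pauli_on_square: "pauli_on js g h * pauli_on js g h = 1\<^sub>m (2 ^ length js)"
  by (induction js) (simp_all add: kronecker_mult qubit_gate_square kronecker_one)

lemma pauli_on_mult:
  "\<exists>c. pauli_on js g h * pauli_on js g' h' =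
     c \<cdot>\<^sub>m pauli_on js (\<lambda>j. g j + g' j) (\<lambda>j. h j + h' j)"
proof (induction js)
  case Nil
  show ?case by (rule exI [of _ 1]) (auto intro!: eq_matI simp: scalar_prod_def)
next
  case (Cons j js)
  obtain c where c: "pauli_on js g h * pauli_on js g' h' =
      c \<cdot>\<^sub>m pauli_on js (\<lambda>j. g j + g' j) (\<lambda>j. h j + h' j)"
    using Cons.IH by blast
  obtain d where d: "qubit_gate (g j) (h j) * qubit_gate (g' j) (h' j) =
      d \<cdot>\<^sub>m qubit_gate (g j + g' j) (h j + h' j)"
    using qubit_gate_mult by blast
  show ?case
    by (rule exI [of _ "d * c"]) (simp only: pauli_on_Cons kronecker_mult
        dim_qubit_gate dim_pauli_on c d kronecker_smult)
qed

lemma pauli_on_commute: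
  "pauli_on js g h * pauli_on js g' h' =
     (if (\<Sum>j\<leftarrow>js. g j * h' j + h j * g' j) = 0 then 1 else - 1) \<cdot>\<^sub>m
       (pauli_on js g' h' * pauli_on js g h)"
proof (induction js)
  case Nil
  show ?case by (auto intro!: eq_matI simp: scalar_prod_def)
next
  case (Cons j js)
  \<comment> \<open>The sign is a homomorphism from bits to 1 and -1, so the signs of the tensor
    factors combine into the sign of a sum.\<close>
  have sgn: "(if a = 0 then 1 else - 1) * (if b = 0 then 1 else - 1) =
    (if a + b = 0 then 1 else - 1 :: complex)" for a b :: bit
    by (cases a; cases b) simp_all
  show ?case
    by (simp only: pauli_on_Cons kronecker_mult dim_qubit_gate dim_pauli_on Cons.IH
        qubit_gate_commute [of "g j" "h j"] kronecker_smult sgn list.map sum_list.Cons)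
qed

text \<open>A zero matrix cannot square to the identity of positive dimension.\<close>

lemma pauli_on_neq_0: "\<exists>k<2 ^ length js. \<exists>l<2 ^ length js. pauli_on js g h $$ (k, l) \<noteq> 0"
proof (rule ccontr)
  assume "\<not> ?thesis"
  then have "(pauli_on js g h * pauli_on js g h) $$ (0, 0) = 0"
    by (simp add: scalar_prod_def)
  then show False by (simp add: pauli_on_square)
qed

lemma qubit_gate_neq_0: "\<exists>i<2. \<exists>j<2. qubit_gate g h $$ (i, j) \<noteq> 0"
  by (rule exI [of _ 0], simp, rule exI [of _ "if h = 0 then 0 else Suc 0"])
    (simp add: qubit_gate_index)

text \<open>The entry \<open>(0, 0)\<close> separates \<open>I\<close>, \<open>Z\<close> from \<open>X\<close>, \<open>Y\<close>; within each class
  the two gates have opposite ratios of their nonzero entries, so they are not proportional.\<close>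

lemma qubit_gate_proportional:
  assumes "\<And>i j. i < 2 \<Longrightarrow> j < 2 \<Longrightarrow> qubit_gate g h $$ (i, j) * x = qubit_gate g' h' $$ (i, j) * y"
    and "x \<noteq> 0"
  shows "g = g' \<and> h = h' \<and> x = y"
  using assms(1) [of 0 0] assms(1) [of 0 1] assms(1) [of 1 0] assms(1) [of 1 1] assms(2)
  by (cases g; cases h; cases g'; cases h') (auto simp: qubit_gate_index)

text \<open>A nonzero entry of the tail shows that the two head gates are proportional, hence equal.
  A nonzero entry of this common head then cancels, leaving equal tails for the induction.\<close>

lemma pauli_on_inj:
  assumes "pauli_on js g h = pauli_on js g' h'" and "j \<in> set js"
  shows "g j = g' j \<and> h j = h' j"
  using assms
proof (induction js)
  case (Cons i js)
  let ?B = "pauli_on js g h" and ?B' = "pauli_on js g' h'"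
  have entries: "qubit_gate (g i) (h i) $$ (a, b) * ?B $$ (k, l) =
      qubit_gate (g' i) (h' i) $$ (a, b) * ?B' $$ (k, l)"
    if "a < 2" "b < 2" "k < 2 ^ length js" "l < 2 ^ length js" for a b k l
    using Cons.prems(1) that
      index_kronecker_block [of a "qubit_gate (g i) (h i)" b k ?B l]
      index_kronecker_block [of a "qubit_gate (g' i) (h' i)" b k ?B' l]
    by simp
  obtain k l where "k < 2 ^ length js" "l < 2 ^ length js" "?B $$ (k, l) \<noteq> 0"
    using pauli_on_neq_0 by blast
  \<comment> \<open>Only \<open>?B\<close> is known to be nonzero at \<open>(k, l)\<close>, which is
    all that the proportionality lemma asks for.\<close>
  then have i: "g i = g' i \<and> h i = h' i"
    using entries qubit_gate_proportional [of "g i" "h i" "?B $$ (k, l)" "g' i" "h' i"] by blast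
  have "?B = ?B'"
  proof (rule eq_matI)
    fix k l
    assume "k < dim_row ?B'" "l < dim_col ?B'"
    then have kl: "k < 2 ^ length js" "l < 2 ^ length js" by simp_all
    obtain a b where "a < 2" "b < 2" "qubit_gate (g i) (h i) $$ (a, b) \<noteq> 0"
      using qubit_gate_neq_0 by blast
    with entries kl i show "?B $$ (k, l) = ?B' $$ (k, l)"
      by (metis mult_left_cancel)
  qed simp_all
  with Cons i show ?case by auto
qed simp

lemma pauli_obs_eq: "pauli_obs N g = pauli_on [0..<N] (\<lambda>j. g $ j) (\<lambda>j. g $ (N + j))"
  by (simp add: pauli_obs_def pauli_on_def)

lemma pauli_obs_carrier [simp]: "pauli_obs N g \<in> carrier_mat (2 ^ N) (2 ^ N)"
  using pauli_on_carrier [of "[0..<N]"] by (simp add: pauli_obs_eq)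

lemma pauli_obs_square: "pauli_obs N g * pauli_obs N g = 1\<^sub>m (2 ^ N)"
  by (simp add: pauli_obs_eq pauli_on_square)

lemma pauli_obs_observable: "observable N (pauli_obs N g)"
  by (simp add: observable_def) (simp add: pauli_obs_eq pauli_on_adjoint)

lemma pauli_obs_commute:
  assumes "symp N g h = 0"
  shows "pauli_obs N g * pauli_obs N h = pauli_obs N h * pauli_obs N g"
proof -
  have "(\<Sum>j\<leftarrow>[0..<N]. g $ j * h $ (N + j) + g $ (N + j) * h $ j) = symp N g h"
    unfolding symp_def by (simp only: interv_sum_list_conv_sum_set_nat set_upt atLeast0LessThan)
  with assms show ?thesis
    using pauli_on_commute [of "[0..<N]" "\<lambda>j. g $ j" "\<lambda>j. g $ (N + j)" "\<lambda>j. h $ j" "\<lambda>j. h $ (N + j)"]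
    by (simp only: pauli_obs_eq if_True refl) (auto intro!: eq_matI)
qed

lemma pauli_obs_mult:
  assumes "g \<in> carrier_vec (2 * N)" "h \<in> carrier_vec (2 * N)"
  shows "\<exists>c. pauli_obs N g * pauli_obs N h = c \<cdot>\<^sub>m pauli_obs N (g + h)"
proof -
  have "pauli_obs N (g + h) =
      pauli_on [0..<N] (\<lambda>j. g $ j + h $ j) (\<lambda>j. g $ (N + j) + h $ (N + j))"
    unfolding pauli_obs_eq pauli_on_def using assms
    by (intro arg_cong2 [where f = "foldr kronecker"] map_cong refl)
      (auto simp del: add_bit_eq_xor)
  then show ?thesis
    using pauli_on_mult by (simp only: pauli_obs_eq)
qed

lemma inj_on_pauli_obs: "inj_on (pauli_obs N) (carrier_vec (2 * N))"
proof (rule inj_onI)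
  fix g h :: "bit vec"
  assume gh: "g \<in> carrier_vec (2 * N)" "h \<in> carrier_vec (2 * N)" "pauli_obs N g = pauli_obs N h"
  have eq: "g $ j = h $ j \<and> g $ (N + j) = h $ (N + j)" if "j < N" for j
    using pauli_on_inj [OF gh(3) [unfolded pauli_obs_eq], of j] that by simp
  show "g = h"
  proof (rule eq_vecI)
    fix i assume "i < dim_vec h"
    then have "i < 2 * N" using gh by auto
    then show "g $ i = h $ i"
      using eq [of i] eq [of "i - N"] by (cases "i < N") auto
  qed (use gh in auto)
qed

section \<open>Lines of the symplectic polar space\<close>

text \<open>In characteristic two every vector is its own negative; hence any two points of a line
  add up to the third.\<close>

lemma bit_vec_add_cancel:
  fixes a b :: "bit vec"
  assumes "a \<in> carrier_vec n" "b \<in> carrier_vec n"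
  shows "a + (a + b) = b"
proof (rule eq_vecI)
  fix i assume "i < dim_vec b"
  with assms show "(a + (a + b)) $ i = b $ i"
    by (cases "a $ i"; cases "b $ i") auto
qed (use assms in auto)

lemma bit_vec_add_eq_0_iff:
  fixes a b :: "bit vec"
  assumes "a \<in> carrier_vec n" "b \<in> carrier_vec n"
  shows "a + b = 0\<^sub>v n \<longleftrightarrow> a = b"
proof
  assume "a + b = 0\<^sub>v n"
  then have "a + 0\<^sub>v n = b" using bit_vec_add_cancel [OF assms] by simp
  then show "a = b" using assms by simp
next
  assume "a = b"
  then show "a + b = 0\<^sub>v n"
    using assms by (intro eq_vecI) auto
qed

lemma symp_commute: "symp N a b = symp N b a"
  unfolding symp_def by (rule sum.cong) (simp_all only: ac_simps)

lemma symp_self: "symp N a a = 0"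
proof -
  have "a $ i * a $ (N + i) + a $ (N + i) * a $ i = 0" for i
    by (cases "a $ i"; cases "a $ (N + i)") simp_all
  then show ?thesis unfolding symp_def by (simp only: sum.neutral_const)
qed

lemma symp_add:
  assumes "b \<in> carrier_vec (2 * N)" "c \<in> carrier_vec (2 * N)"
  shows "symp N a (b + c) = symp N a b + symp N a c"
proof -
  have "a $ i * (b + c) $ (N + i) + a $ (N + i) * (b + c) $ i =
      (a $ i * b $ (N + i) + a $ (N + i) * b $ i) + (a $ i * c $ (N + i) + a $ (N + i) * c $ i)"
    if "i < N" for i
  proof -
    have "(b + c) $ (N + i) = b $ (N + i) + c $ (N + i)" "(b + c) $ i = b $ i + c $ i"
      using assms that by (auto simp del: add_bit_eq_xor)
    then show ?thesis by (simp only: ring_distribs ac_simps)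
  qed
  then show ?thesis
    unfolding symp_def sum.distrib [symmetric] by (intro sum.cong) simp_all
qed

lemma W_points_carrier: "a \<in> W_points N \<Longrightarrow> a \<in> carrier_vec (2 * N)"
  by (simp add: W_points_def)

lemma W_points_add:
  assumes "a \<in> W_points N" "b \<in> W_points N" "a \<noteq> b"
  shows "a + b \<in> W_points N"
  using assms bit_vec_add_eq_0_iff [of a "2 * N" b] by (auto simp: W_points_def)

text \<open>The three points of a line play symmetric roles: by bilinearity all pairs are
  orthogonal, and each point is the sum of the other two. Any two distinct points may therefore
  serve as generators.\<close>

lemma W_linesE:
  assumes "l \<in> W_lines N" "x \<in> l" "y \<in> l" "x \<noteq> y"
  obtains "x \<in> W_points N" "y \<in> W_points N" "symp N x y = 0" "l = {x, y, x + y}"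
proof -
  obtain a b where ab: "l = {a, b, a + b}" "a \<in> W_points N" "b \<in> W_points N" "a \<noteq> b"
    "symp N a b = 0"
    using assms(1) by (auto simp: W_lines_def)
  note carr = ab(2,3) [THEN W_points_carrier]
  have comm: "b + a = a + b" "a + b + a = b" "a + b + b = a" "a + (a + b) = b" "b + (a + b) = a"
    using carr bit_vec_add_cancel [OF carr] bit_vec_add_cancel [OF carr(2,1)]
    by (metis add_carrier_vec comm_add_vec)+
  have zero: "symp N a (a + b) = 0" "symp N b (a + b) = 0" "symp N b a = 0"
    using symp_add [OF carr] ab(5) symp_commute [of N b a] by (simp_all add: symp_self)
  then have zero': "symp N (a + b) a = 0" "symp N (a + b) b = 0"
    using symp_commute by metis+
  have "x = a \<or> x = b \<or> x = a + b" "y = a \<or> y = b \<or> y = a + b"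
    using assms(2,3) by (auto simp: ab(1))
  then have "x \<in> W_points N \<and> y \<in> W_points N \<and> symp N x y = 0 \<and> l = {x, y, x + y}"
    using assms(4) ab(2,3) W_points_add [OF ab(2-4)]
    by (elim disjE; simp only: ab(1,5) zero zero' comm) auto
  with that show ?thesis by blast
qed

lemma finite_W_points: "finite (W_points N)"
proof (rule finite_subset)
  show "W_points N \<subseteq> vec (2 * N) ` ({..<2 * N} \<rightarrow>\<^sub>E UNIV)"
  proof
    fix v :: "bit vec" assume "v \<in> W_points N"
    then have "v = vec (2 * N) (restrict (\<lambda>i. v $ i) {..<2 * N})"
      by (intro eq_vecI) (auto simp: W_points_def)
    then show "v \<in> vec (2 * N) ` ({..<2 * N} \<rightarrow>\<^sub>E UNIV)"
      by (rule image_eqI [of _ "vec (2 * N)"]) (simp add: PiE_def)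
  qed
  have "(UNIV :: bit set) = {0, 1}"
    by auto
  then have "finite (UNIV :: bit set)" by (metis finite.emptyI finite.insertI)
  then show "finite (vec (2 * N) ` ({..<2 * N} \<rightarrow>\<^sub>E (UNIV :: bit set)))"
    by (intro finite_imageI finite_PiE) simp_all
qed

section \<open>Signs of lines\<close>

text \<open>\<open>context_product\<close> quantifies over all orderings of a context. Distinctness
  forces lists of length three, and commutation identifies the six right-nested products.\<close>

lemma foldr_commuting_triple:
  fixes A B C :: "'a :: semiring_1 mat"
  assumes carr: "A \<in> carrier_mat n n" "B \<in> carrier_mat n n" "C \<in> carrier_mat n n"
    and comm: "A * B = B * A" "A * C = C * A" "B * C = C * B"
    and neq: "A \<noteq> B" "A \<noteq> C" "B \<noteq> C"
    and ms: "distinct ms" "set ms = {A, B, C}"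
  shows "foldr (*) ms (1\<^sub>m n) = A * B * C"
proof -
  have "length ms = 3" using neq distinct_card [OF ms(1)] ms(2) by simp
  then obtain x y z where xyz: "ms = [x, y, z]"
    by (auto simp: numeral_3_eq_3 length_Suc_conv)
  have perms: "(x, y, z) \<in> {(A, B, C), (A, C, B), (B, A, C), (B, C, A), (C, A, B), (C, B, A)}"
  proof -
    have "x \<in> {A, B, C}" "y \<in> {A, B, C}" "z \<in> {A, B, C}"
      using ms(2) by (auto simp: xyz)
    then show ?thesis
      using ms(1) unfolding xyz by (elim insertE emptyE) simp_all
  qed
  note assoc = assoc_mult_mat [of _ n n _ n _ n]
  have *: "A * (B * C) = A * B * C" "B * (A * C) = A * B * C" "C * (A * B) = A * B * C"
    using carr comm by (metis assoc)+
  then have "A * (C * B) = A * B * C" "B * (C * A) = A * B * C" "C * (B * A) = A * B * C"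
    using comm by simp_all
  with * show ?thesis
    using perms carr by (elim insertE emptyE) (simp_all add: xyz)
qed

text \<open>Write \<open>A * B\<close> as \<open>c\<close> times \<open>C\<close>. Since
  \<open>A\<close> and \<open>B\<close> commute and all three square to the identity, squaring gives
  \<open>c * c = 1\<close>, and multiplying by \<open>C\<close> leaves the scalar
  \<open>c\<close>.\<close>

lemma pauli_obs_line:
  assumes "a \<in> W_points N" "b \<in> W_points N" "symp N a b = 0"
  shows "\<exists>c \<in> {1, - 1}. pauli_obs N a * pauli_obs N b * pauli_obs N (a + b) = c \<cdot>\<^sub>m 1\<^sub>m (2 ^ N)"
proof -
  let ?A = "pauli_obs N a" and ?B = "pauli_obs N b" and ?C = "pauli_obs N (a + b)"
  let ?n = "2 ^ N :: nat"
  note carr = pauli_obs_carrier [of N a] pauli_obs_carrier [of N b] pauli_obs_carrier [of N "a + b"]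
  obtain c where c: "?A * ?B = c \<cdot>\<^sub>m ?C"
    using pauli_obs_mult assms(1,2) W_points_carrier by blast
  have "(?A * ?B) * (?A * ?B) = ?A * (?B * ?A) * ?B"
    using carr by (metis assoc_mult_mat mult_carrier_mat)
  also have "\<dots> = ?A * (?A * ?B) * ?B"
    using pauli_obs_commute [OF assms(3)] by simp
  also have "\<dots> = (?A * ?A) * (?B * ?B)"
    using carr by (metis assoc_mult_mat mult_carrier_mat)
  also have "\<dots> = 1\<^sub>m ?n"
    by (simp add: pauli_obs_square)
  finally have "(c \<cdot>\<^sub>m ?C) * (c \<cdot>\<^sub>m ?C) = 1\<^sub>m ?n"
    by (simp add: c)
  moreover have "(c \<cdot>\<^sub>m ?C) * (c \<cdot>\<^sub>m ?C) = (c * c) \<cdot>\<^sub>m 1\<^sub>m ?n"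
    using carr(3) pauli_obs_square [of N "a + b"]
    by (simp add: mult_smult_assoc_mat [of _ ?n ?n _ ?n] mult_smult_distrib [of _ ?n ?n _ ?n])
      (auto intro!: eq_matI)
  \<comment> \<open>The dimension is a power of two, hence positive, so the entry
    \<open>(0, 0)\<close> exists and detects the scalar.\<close>
  ultimately have "((c * c) \<cdot>\<^sub>m 1\<^sub>m ?n) $$ (0, 0) = (1\<^sub>m ?n :: complex mat) $$ (0, 0)"
    by simp
  then have "c * c = 1" by simp
  then have "c \<in> {1, - 1}" by (simp add: square_eq_1_iff)
  moreover have "?A * ?B * ?C = c \<cdot>\<^sub>m 1\<^sub>m ?n"
    using carr(3) by (simp add: c mult_smult_assoc_mat [of _ ?n ?n _ ?n] pauli_obs_square)
  ultimately show ?thesis by blast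
qed

lemma line_context_sign:
  assumes "l \<in> W_lines N"
  shows "positive_context N (pauli_obs N ` l) \<or> negative_context N (pauli_obs N ` l)"
proof -
  obtain a b where ab: "l = {a, b, a + b}" "a \<in> W_points N" "b \<in> W_points N" "a \<noteq> b"
    "symp N a b = 0"
    using assms by (auto simp: W_lines_def)
  note carr = ab(2,3) [THEN W_points_carrier]
  let ?A = "pauli_obs N a" and ?B = "pauli_obs N b" and ?C = "pauli_obs N (a + b)"
  have orth: "symp N a (a + b) = 0" "symp N b (a + b) = 0"
    using symp_add [OF carr] ab(5) symp_commute [of N b a] by (simp_all add: symp_self)
  \<comment> \<open>Either equality would make \<open>b\<close> or \<open>a\<close> the zero vector,
    which is not a point. With injectivity, the context then has three distinct matrices.\<close>
  have "a + b \<noteq> a" "a + b \<noteq> b"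
    using ab(2,3) carr bit_vec_add_cancel [OF carr] bit_vec_add_cancel [OF carr(2,1)]
      bit_vec_add_eq_0_iff [of a "2 * N" a] bit_vec_add_eq_0_iff [of b "2 * N" b]
      comm_add_vec [OF carr]
    by (auto simp: W_points_def)
  then have neq: "?A \<noteq> ?B" "?A \<noteq> ?C" "?B \<noteq> ?C"
    using ab(4) carr inj_on_pauli_obs [of N, THEN inj_onD] by (metis add_carrier_vec)+
  obtain c where c: "c \<in> {1, - 1}" "?A * ?B * ?C = c \<cdot>\<^sub>m 1\<^sub>m (2 ^ N)"
    using pauli_obs_line ab by blast
  have "context_product N (pauli_obs N ` l) (c \<cdot>\<^sub>m 1\<^sub>m (2 ^ N))"
    unfolding context_product_def
  proof (intro conjI allI impI)
    show "finite (pauli_obs N ` l)" by (simp add: ab(1))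
    fix ms
    assume "distinct ms \<and> set ms = pauli_obs N ` l"
    then have ms: "distinct ms" "set ms = {?A, ?B, ?C}" by (simp_all add: ab(1))
    show "foldr (*) ms (1\<^sub>m (2 ^ N)) = c \<cdot>\<^sub>m 1\<^sub>m (2 ^ N)"
      unfolding c(2) [symmetric]
      by (rule foldr_commuting_triple)
        (rule pauli_obs_carrier pauli_obs_commute ab(5) orth neq ms)+
  qed
  moreover have "(1 :: complex) \<cdot>\<^sub>m 1\<^sub>m (2 ^ N) = 1\<^sub>m (2 ^ N)"
    "(- 1 :: complex) \<cdot>\<^sub>m 1\<^sub>m (2 ^ N) = - 1\<^sub>m (2 ^ N)"
    by (auto intro!: eq_matI)
  ultimately show ?thesis
    using c(1) by (auto simp: positive_context_def negative_context_def)
qed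

section \<open>Perpsets\<close>

lemma perpset_line_through:
  assumes "l \<in> perpset_lines N p" "q \<in> l" "q \<noteq> p"
  shows "q \<in> perpset_points N p" "l = {p, q, p + q}"
proof -
  have l: "l \<in> W_lines N" "p \<in> l" using assms(1) by (simp_all add: perpset_lines_def)
  show "q \<in> perpset_points N p" "l = {p, q, p + q}"
    using W_linesE [OF l assms(2) assms(3) [symmetric]] by (auto simp: perpset_points_def)
qed

lemma perpset_lines_subset:
  assumes "p \<in> W_points N" "l \<in> perpset_lines N p"
  shows "l \<subseteq> perpset_points N p"
proof
  fix q assume "q \<in> l"
  then show "q \<in> perpset_points N p"
    using assms perpset_line_through(1) [OF assms(2)]
    by (cases "q = p") (auto simp: perpset_points_def symp_self)
qed

lemma perpset_points_carrier: "perpset_points N p \<subseteq> carrier_vec (2 * N)"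
  by (auto simp: perpset_points_def W_points_def)

lemma finite_perpset_observables: "finite (perpset_observables N p)"
  unfolding perpset_observables_def perpset_points_def by (simp add: finite_W_points)

lemma perpset_contexts_subset:
  assumes "p \<in> W_points N"
  shows "perpset_contexts N p \<subseteq> Pow (perpset_observables N p)"
  using perpset_lines_subset [OF assms]
  unfolding perpset_contexts_def perpset_observables_def by blast

lemma quantum_configuration_perpset:
  assumes "p \<in> W_points N"
  shows "quantum_configuration N (perpset_observables N p) (perpset_contexts N p)"
  unfolding quantum_configuration_def
proof (intro conjI ballI)
  show "finite (perpset_contexts N p)"
    using perpset_contexts_subset [OF assms] finite_perpset_observables
    by (meson finite_Pow_iff finite_subset)
next
  fix M assume "M \<in> perpset_observables N p"
  then show "observable N M" "M * M = 1\<^sub>m (2 ^ N)"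
    by (auto simp: perpset_observables_def pauli_obs_observable pauli_obs_square)
next
  fix c A B
  assume "c \<in> perpset_contexts N p" "A \<in> c" "B \<in> c"
  then obtain l a b where l: "l \<in> W_lines N" "a \<in> l" "b \<in> l" "A = pauli_obs N a" "B = pauli_obs N b"
    by (auto simp: perpset_contexts_def perpset_lines_def)
  then show "A * B = B * A"
    by (cases "a = b") (auto elim: W_linesE [of l N a b] intro: pauli_obs_commute)
next
  fix c assume "c \<in> perpset_contexts N p"
  then show "positive_context N c \<or> negative_context N c"
    using line_context_sign by (auto simp: perpset_contexts_def perpset_lines_def)
qed (use finite_perpset_observables perpset_contexts_subset [OF assms] in auto)

text \<open>Injectivity pulls \<open>M\<close> back to one point \<open>q\<close> other than
  \<open>p\<close> on both lines, and \<open>p\<close> and \<open>q\<close> determine the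
  line.\<close>

lemma perpset_contexts_unique:
  assumes p: "p \<in> W_points N" and c: "c \<in> perpset_contexts N p" "c' \<in> perpset_contexts N p"
    and M: "M \<in> c" "M \<in> c'" "M \<noteq> pauli_obs N p"
  shows "c = c'"
proof -
  obtain l l' where l: "l \<in> perpset_lines N p" "c = pauli_obs N ` l"
    "l' \<in> perpset_lines N p" "c' = pauli_obs N ` l'"
    using c by (auto simp: perpset_contexts_def)
  obtain q q' where q: "q \<in> l" "M = pauli_obs N q" "q' \<in> l'" "M = pauli_obs N q'"
    using M l by auto
  have "q \<in> carrier_vec (2 * N)" "q' \<in> carrier_vec (2 * N)"
    using q l perpset_lines_subset [OF p] perpset_points_carrier by blast+
  then have "q = q'"
    using q inj_onD [OF inj_on_pauli_obs [of N]] by simp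
  moreover have "q \<noteq> p" "q' \<noteq> p" using M(3) q by auto
  ultimately show ?thesis
    using perpset_line_through(2) l q by metis
qed

section \<open>Solving the linear system\<close>

text \<open>An enumeration without repetition is a bijection from indices to observables, so a
  solution can be sought as a function on matrices, independently of any numbering.\<close>

lemma incidence_mult_vec:
  assumes "distinct os" "set os = Obs" "k < length cs" "cs ! k \<subseteq> Obs"
  shows "(incidence_matrix cs os *\<^sub>v vec (length os) (\<lambda>j. f (os ! j))) $ k = (\<Sum>M\<in>cs ! k. f M)"
proof -
  have "(incidence_matrix cs os *\<^sub>v vec (length os) (\<lambda>j. f (os ! j))) $ k =
      (\<Sum>j<length os. (if os ! j \<in> cs ! k then 1 else 0) * f (os ! j))"
    using assms(3)
    by (auto simp: incidence_matrix_def scalar_prod_def atLeast0LessThan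
        simp del: mult_bit_eq_and intro!: sum.cong)
  also have "\<dots> = (\<Sum>M\<in>Obs. (if M \<in> cs ! k then 1 else 0) * f M)"
    using assms(1,2) by (intro sum.reindex_bij_betw bij_betw_nth) auto
  also have "\<dots> = (\<Sum>M\<in>Obs. if M \<in> cs ! k then f M else 0)"
    by (rule sum.cong) auto
  also have "\<dots> = (\<Sum>M\<in>cs ! k. f M)"
    using assms(2,4) by (subst sum.inter_restrict [symmetric]) (auto simp: Int_absorb1)
  finally show ?thesis .
qed

text \<open>The lines of the perpset meet only in \<open>p\<close>, so their equations can be solved independently.
  Choose a coordinate \<open>i\<close> with \<open>p $ i = 1\<close>. Of the two points \<open>q\<close> and \<open>p + q\<close> other than
  \<open>p\<close> on a line of the perpset, exactly one vanishes at \<open>i\<close>; let it carry the sign of the line.\<close>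

lemma perpset_valuation:
  assumes p: "p \<in> W_points N"
  shows "\<exists>f :: complex mat \<Rightarrow> bit. \<forall>c \<in> perpset_contexts N p.
    (\<Sum>M\<in>c. f M) = (if negative_context N c then 1 else 0)"
proof -
  obtain i where i: "i < 2 * N" "p $ i = 1"
  proof -
    have "p \<noteq> 0\<^sub>v (2 * N)" "dim_vec p = 2 * N" using p by (auto simp: W_points_def)
    then have "\<exists>i<2 * N. p $ i \<noteq> 0" by (metis eq_vecI index_zero_vec)
    with that show ?thesis by auto
  qed
  \<comment> \<open>The unknowns belong to matrices, so vanishing at \<open>i\<close> is phrased
    through a preimage; injectivity makes it independent of the choice.\<close>
  define marked where "marked M \<longleftrightarrow> (\<exists>q \<in> carrier_vec (2 * N). M = pauli_obs N q \<and> q $ i = 0)" for M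
  \<comment> \<open>The existential ranges over a single context for every observable except that of
    \<open>p\<close>. The latter lies on all contexts but is unmarked, as \<open>p $ i = 1\<close>,
    and gets 0.\<close>
  define f :: "complex mat \<Rightarrow> bit" where
    "f M = (if marked M \<and> (\<exists>c \<in> perpset_contexts N p. M \<in> c \<and> negative_context N c) then 1 else 0)"
    for M
  have marked_iff: "marked (pauli_obs N q) \<longleftrightarrow> q $ i = 0" if "q \<in> carrier_vec (2 * N)" for q
    using inj_on_pauli_obs [of N] that by (auto simp: marked_def dest: inj_onD)
  have "(\<Sum>M\<in>c. f M) = (if negative_context N c then 1 else 0)" if c: "c \<in> perpset_contexts N p" for c
  proof -
    obtain l where l: "l \<in> perpset_lines N p" "c = pauli_obs N ` l"
      using c by (auto simp: perpset_contexts_def)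
    have inj: "inj_on (pauli_obs N) l"
      using inj_on_subset [OF inj_on_pauli_obs] perpset_lines_subset [OF p l(1)]
        perpset_points_carrier by blast
    have "p \<in> l" and "l \<in> W_lines N"
      using l(1) by (simp_all add: perpset_lines_def)
    then obtain a b where "l = {a, b, a + b}" "a \<noteq> b"
      unfolding W_lines_def by blast
    \<comment> \<open>Of two distinct points \<open>a\<close> and \<open>b\<close>, at least one
      differs from \<open>p\<close>.\<close>
    then obtain q where q: "q \<in> l" "q \<noteq> p" by blast
    have line: "l = {p, q, p + q}" and qp: "q \<in> carrier_vec (2 * N)"
      using perpset_line_through [OF l(1) q] perpset_points_carrier by auto
    note carr = W_points_carrier [OF p] qp
    have f_pauli: "f (pauli_obs N r) = (if r $ i = 0 \<and> negative_context N c then 1 else 0)"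
      if "r \<in> l" for r
    proof (cases "r = p")
      case True
      with i carr show ?thesis by (simp add: f_def marked_iff)
    next
      case False
      have r: "r \<in> carrier_vec (2 * N)"
        using that perpset_lines_subset [OF p l(1)] perpset_points_carrier by blast
      then have "pauli_obs N r \<noteq> pauli_obs N p"
        using False carr inj_onD [OF inj_on_pauli_obs [of N]] by blast
      then have "(\<exists>c' \<in> perpset_contexts N p. pauli_obs N r \<in> c' \<and> negative_context N c') \<longleftrightarrow>
          negative_context N c"
        using perpset_contexts_unique [OF p c] c that l(2) by blast
      then show ?thesis by (simp add: f_def marked_iff [OF r])
    qed
    have "p + q \<noteq> p" "p + q \<noteq> q"
      using p perpset_line_through(1) [OF l(1) q] carr bit_vec_add_cancel [OF carr]
        bit_vec_add_eq_0_iff [of p "2 * N" p] bit_vec_add_cancel [OF carr(2,1)]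
        bit_vec_add_eq_0_iff [of q "2 * N" q] comm_add_vec [OF carr]
      by (auto simp: W_points_def perpset_points_def)
    \<comment> \<open>Adding \<open>p\<close> flips the bit at \<open>i\<close>, so exactly one of
      \<open>q\<close> and \<open>p + q\<close> carries the sign.\<close>
    moreover have "(p + q) $ i = 0 \<longleftrightarrow> q $ i \<noteq> 0"
      using carr i by (cases "q $ i") auto
    moreover have "(\<Sum>M\<in>c. f M) = (\<Sum>r\<in>l. f (pauli_obs N r))"
      unfolding l(2) by (simp only: sum.reindex [OF inj] o_def)
    moreover have "f (pauli_obs N p) = 0"
      using f_pauli [of p] \<open>p \<in> l\<close> i by simp
    ultimately show ?thesis
      using f_pauli [of q] f_pauli [of "p + q"] q(2) by (simp add: line)
  qed
  then show ?thesis by blast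
qed

theorem proposition2:
  fixes N :: nat and p :: "bit vec"
  assumes "N \<ge> 1" and "p \<in> W_points N"
  shows "quantum_configuration N (perpset_observables N p) (perpset_contexts N p) \<and>
    \<not> contextual N (perpset_observables N p) (perpset_contexts N p)"
proof
  show "quantum_configuration N (perpset_observables N p) (perpset_contexts N p)"
    using assms(2) by (rule quantum_configuration_perpset)
  obtain f :: "complex mat \<Rightarrow> bit" where f: "\<And>c. c \<in> perpset_contexts N p \<Longrightarrow>
      (\<Sum>M\<in>c. f M) = (if negative_context N c then 1 else 0)"
    using perpset_valuation [OF assms(2)] by blast
  show "\<not> contextual N (perpset_observables N p) (perpset_contexts N p)"
    unfolding contextual_def
  proof (clarify)
    fix os cs
    assume os: "distinct os" "set os = perpset_observables N p" and cs: "set cs = perpset_contexts N p"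
      and unsolvable: "\<not> (\<exists>x \<in> carrier_vec (length os).
        incidence_matrix cs os *\<^sub>v x = valuation_vector N cs)"
    \<comment> \<open>\<open>contextual\<close> asks for some bad pair of enumerations, so every
      pair must be handled; listing the values of \<open>f\<close> along \<open>os\<close> always
      gives a solution.\<close>
    have "incidence_matrix cs os *\<^sub>v vec (length os) (\<lambda>j. f (os ! j)) = valuation_vector N cs"
    proof (rule eq_vecI)
      fix k assume "k < dim_vec (valuation_vector N cs)"
      then have k: "k < length cs" by (simp add: valuation_vector_def)
      then have ck: "cs ! k \<in> perpset_contexts N p" using cs nth_mem by blast
      then have "cs ! k \<subseteq> perpset_observables N p"
        using perpset_contexts_subset [OF assms(2)] by blast
      then show "(incidence_matrix cs os *\<^sub>v vec (length os) (\<lambda>j. f (os ! j))) $ k =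
          valuation_vector N cs $ k"
        using k by (simp only: incidence_mult_vec [OF os k] f [OF ck])
          (simp add: valuation_vector_def)
    qed (simp add: incidence_matrix_def valuation_vector_def)
    with unsolvable show False by auto
  qed
qed

end
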